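(* Let $n \geq 2$ and let $P \subseteq \mathbb{R}^n$ be a rational polyhedron whose integer hull is nonempty. Assume that $0 \in P$, let $d \ge 1$ be the dimension of $P$, and let $L \in \mathbb{Z}^{n \times d}$ be a matrix whose columns form a basis of the lattice $\mathbb{Z}^n \cap \operatorname{aff}(P)$. Then the depth of the integer hull of $P$ satisfies \[ \operatorname{depth}_P(\operatorname{conv}(P \cap \mathbb{Z}^n)) < \sqrt{\lambda_d}\,\sqrt{\tfrac{d+1}{2}}, \] where $\lambda_d$ is the largest eigenvalue of $L^T L$.
   Context: $\|\cdot\|$ is the Euclidean norm on $\mathbb{R}^n$, and $B(x,r) := \{y \in \mathbb{R}^n : \|y-x\| \le r\}$ for $r \in \mathbb{R}_+$. For $P \subseteq \mathbb{R}^n$ and $x \in P$, $\operatorname{depth}_P(x) := \sup\{ r \in \mathbb{R}_+ : B(x,r) \cap \operatorname{aff}(P) \subseteq P\}$, where $\operatorname{aff}(P)$ is the affine hull of $P$. For $S \subseteq P$, $\operatorname{depth}_P(S) := \sup\{\operatorname{depth}_P(x) : x \in P \setminus S\}$. Suprema are taken in $[0,+\infty]$, so the supremum of the empty set is $0$. The integer hull of $P$ is $\operatorname{conv}(P \cap \mathbb{Z}^n)$. (In the source, $0 \in P$ is assumed without loss of generality as part of the statement.) *)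

theory Defs
  imports "HOL-Analysis.Analysis"
begin

definition int_lattice :: "(real ^ 'n) set" where
  "int_lattice = {x. \<forall>i. x $ i \<in> \<int>}"

(* The solution set of a finite system of inequalities a . x <= b with rational data;
   a = 0 is allowed, as a zero row is in a system A x <= b. *)
definition rational_polyhedron :: "(real ^ 'n) set \<Rightarrow> bool" where
  "rational_polyhedron P \<longleftrightarrow>
     (\<exists>F :: ((real ^ 'n) \<times> real) set.
        finite F \<and>
        (\<forall>(a, b)\<in>F. (\<forall>i. a $ i \<in> \<rat>) \<and> b \<in> \<rat>) \<and>
        P = {x. \<forall>(a, b)\<in>F. a \<bullet> x \<le> b})"

definition integer_hull :: "(real ^ 'n) set \<Rightarrow> (real ^ 'n) set" where
  "integer_hull P = convex hull (P \<inter> int_lattice)"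

(* The columns of L are pairwise distinct, linearly independent over the reals, and their
   integer linear combinations are exactly the elements of the lattice. *)
definition lattice_basis :: "real ^ 'd ^ 'n \<Rightarrow> (real ^ 'n) set \<Rightarrow> bool" where
  "lattice_basis L \<Lambda> \<longleftrightarrow>
     inj (\<lambda>j. column j L) \<and> independent (columns L) \<and>
     \<Lambda> = {L *v z | z. z \<in> int_lattice}"

(* Depths are valued in ennreal, whose supremum of the empty set is 0. *)
definition point_depth :: "'a::euclidean_space set \<Rightarrow> 'a \<Rightarrow> ennreal" where
  "point_depth P x = Sup {ennreal r | r. 0 \<le> r \<and> cball x r \<inter> affine hull P \<subseteq> P}"

definition depth :: "'a::euclidean_space set \<Rightarrow> 'a set \<Rightarrow> ennreal" where
  "depth P S = (SUP x \<in> P - S. point_depth P x)"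

definition eigenvalues :: "real ^ 'd ^ 'd \<Rightarrow> real set" where
  "eigenvalues A = {c. \<exists>v. v \<noteq> 0 \<and> A *v v = c *\<^sub>R v}"

(* Only real eigenvalues are considered. This is meant for symmetric A, all of whose complex
   eigenvalues are real, so that the set is finite and nonempty and Max is meaningful. *)
definition largest_eigenvalue :: "real ^ 'd ^ 'd \<Rightarrow> real" where
  "largest_eigenvalue A = Max (eigenvalues A)"

end

theory Submission
  imports Defs
begin

text \<open>
  Write a point of \<open>aff P\<close> as \<open>L z\<close>. Since \<open>\<parallel>L y\<parallel> \<le> sqrt \<lambda> \<parallel>y\<parallel>\<close>, it suffices to bound depths in the
  preimage of \<open>P\<close> under \<open>L\<close> with respect to the standard lattice. There every point \<open>f\<close> of the unit
  cube is a convex combination of cube vertices at squared distance at most \<open>(d + 3) / 4\<close>: on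
  cube vertices the squared distance to \<open>f\<close> is an affine function, the level set of that function
  through \<open>f\<close> has extreme points with at most one fractional coordinate, and rounding this
  coordinate both ways changes the function by little. For \<open>d \<ge> 2\<close> this is
  smaller than \<open>(d + 1) / 2\<close>; for \<open>d = 1\<close> both are equal and strictness comes from \<open>P\<close> being closed.
\<close>

section \<open>The largest eigenvalue of a Gram matrix\<close>

lemma inner_gram:
  fixes L :: "real ^ 'd ^ 'n"
  shows "x \<bullet> ((transpose L ** L) *v y) = (L *v x) \<bullet> (L *v y)"
  by (metis dot_lmul_matrix inner_commute matrix_vector_mul_assoc transpose_matrix_vector)

text \<open>Eigenvectors of a self-adjoint map for different eigenvalues are orthogonal, hence
  independent, which bounds their number. Finiteness is what makes \<open>Max\<close> in
  \<open>largest_eigenvalue\<close> usable.\<close>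

lemma finite_eigenvalues_symmetric:
  fixes A :: "real ^ 'd ^ 'd"
  assumes sym: "\<And>x y. x \<bullet> (A *v y) = (A *v x) \<bullet> y"
  shows "finite (eigenvalues A)"
proof -
  have "\<forall>c\<in>eigenvalues A. \<exists>v. v \<noteq> 0 \<and> A *v v = c *\<^sub>R v"
    by (auto simp: eigenvalues_def)
  then obtain v where v: "\<And>c. c \<in> eigenvalues A \<Longrightarrow> v c \<noteq> 0 \<and> A *v v c = c *\<^sub>R v c"
    by metis
  have orth: "v c \<bullet> v c' = 0" if "c \<in> eigenvalues A" "c' \<in> eigenvalues A" "c \<noteq> c'" for c c'
    using sym[of "v c" "v c'"] v[OF that(1)] v[OF that(2)] that(3) by simp
  have "inj_on v (eigenvalues A)"
    by (rule inj_onI) (metis orth v inner_eq_zero_iff)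
  moreover have "independent (v ` eigenvalues A)"
    by (rule pairwise_orthogonal_independent)
      (auto simp: pairwise_def orthogonal_def v, metis orth)
  ultimately show ?thesis
    using finiteI_independent finite_imageD by blast
qed

text \<open>By compactness \<open>norm (L *v z)\<close> has a maximizer \<open>v\<close> on the unit
  sphere. Optimality makes \<open>v\<close> an eigenvector of the Gram matrix for the squared
  maximum \<open>\<mu>\<close>, and the bound by \<open>\<mu>\<close> at any other eigenvector shows
  that no eigenvalue exceeds \<open>\<mu>\<close>.\<close>

lemma norm_matrix_vector_le_largest_eigenvalue:
  fixes L :: "real ^ 'd ^ 'n"
  shows "norm (L *v z) \<le> sqrt (largest_eigenvalue (transpose L ** L)) * norm z"
proof -
  define A where "A = transpose L ** L"
  have A: "x \<bullet> (A *v y) = (L *v x) \<bullet> (L *v y)" for x y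
    unfolding A_def by (rule inner_gram)
  have "sphere (0 :: real ^ 'd) 1 \<noteq> {}"
    by simp
  moreover have "continuous_on (sphere 0 1) (\<lambda>z. norm (L *v z))"
    by (intro continuous_intros matrix_vector_mult_linear_continuous_on)
  ultimately obtain v where v: "norm v = 1" "\<And>z. norm z = 1 \<Longrightarrow> norm (L *v z) \<le> norm (L *v v)"
    using continuous_attains_sup[OF compact_sphere, of 0 1 "\<lambda>z. norm (L *v z)"] by auto
  define \<mu> where "\<mu> = (norm (L *v v))\<^sup>2"
  have bound: "norm (L *v z) \<le> norm (L *v v) * norm z" for z
  proof (cases "z = 0")
    case False
    have "norm (L *v z) / norm z = norm (L *v (z /\<^sub>R norm z))"
      by (simp add: matrix_vector_mult_scaleR divide_inverse mult.commute)
    also have "\<dots> \<le> norm (L *v v)"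
      by (rule v) (use False in simp)
    finally show ?thesis
      using False by (simp add: field_simps)
  qed simp
  have bound2: "(L *v z) \<bullet> (L *v z) \<le> \<mu> * (z \<bullet> z)" for z
    using power_mono[OF bound norm_ge_zero, of z 2]
    by (simp add: \<mu>_def power_mult_distrib flip: power2_norm_eq_inner)
  have "A *v v = \<mu> *\<^sub>R v"
  proof -
    \<comment> \<open>First-order optimality: \<open>bound2\<close> at
      \<open>v + t *\<^sub>R w\<close> is an equality for \<open>t = 0\<close>, so its linear term
      in \<open>t\<close> must vanish. With the residual itself as direction \<open>w\<close>, this
      term is a multiple of \<open>w \<bullet> w\<close>; \<open>K\<close> collects the quadratic
      terms.\<close>
    define w where "w = A *v v - \<mu> *\<^sub>R v"
    define K where "K = \<mu> * (w \<bullet> w) - (L *v w) \<bullet> (L *v w)"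
    have "K \<ge> 0"
      using bound2[of w] by (simp add: K_def)
    have ineq: "2 * t * (w \<bullet> w) \<le> t\<^sup>2 * K" for t
    proof -
      have "(L *v (v + t *\<^sub>R w)) \<bullet> (L *v (v + t *\<^sub>R w))
          = \<mu> + 2 * t * (w \<bullet> (A *v v)) + t\<^sup>2 * ((L *v w) \<bullet> (L *v w))"
        unfolding \<mu>_def power2_norm_eq_inner A
        by (simp add: matrix_vector_right_distrib matrix_vector_mult_scaleR inner_add_left
            inner_add_right inner_commute power2_eq_square)
      moreover have "\<mu> * ((v + t *\<^sub>R w) \<bullet> (v + t *\<^sub>R w))
          = \<mu> + 2 * t * (w \<bullet> (\<mu> *\<^sub>R v)) + t\<^sup>2 * (\<mu> * (w \<bullet> w))"
        using v(1) by (simp add: inner_add_left inner_add_right inner_commute power2_eq_square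
            norm_eq_1 algebra_simps)
      moreover have "w \<bullet> (A *v v) - w \<bullet> (\<mu> *\<^sub>R v) = w \<bullet> w"
        by (simp add: w_def inner_diff_right)
      ultimately show ?thesis
        using bound2[of "v + t *\<^sub>R w"] by (simp add: K_def algebra_simps)
    qed
    have "w \<bullet> w \<le> 0"
    proof -
      have "2 * (w \<bullet> w) \<le> (1 / (K + 1)) * K * (w \<bullet> w)" if "w \<bullet> w > 0"
      proof -
        \<comment> \<open>A step so short that the quadratic term cannot outweigh the linear one;
          the summand 1 keeps the denominator positive when \<open>K\<close> is 0.\<close>
        define t where "t = (w \<bullet> w) / (K + 1)"
        have "t > 0"
          using that \<open>K \<ge> 0\<close> by (simp add: t_def)
        then have "2 * (w \<bullet> w) \<le> t * K"
          using ineq[of t] by (simp add: power2_eq_square)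
        then show ?thesis
          by (simp add: t_def mult.commute)
      qed
      moreover have "(1 / (K + 1)) * K * (w \<bullet> w) \<le> 1 * (w \<bullet> w)"
        by (rule mult_right_mono) (use \<open>K \<ge> 0\<close> in auto)
      ultimately show ?thesis
        by force
    qed
    then have "w = 0"
      by (metis inner_eq_zero_iff inner_ge_zero order_antisym)
    then show ?thesis
      by (simp add: w_def)
  qed
  then have "\<mu> \<in> eigenvalues A"
    unfolding eigenvalues_def using v(1) by (intro CollectI exI[of _ v]) auto
  moreover have "c \<le> \<mu>" if "c \<in> eigenvalues A" for c
  proof -
    have "\<exists>u. u \<noteq> 0 \<and> A *v u = c *\<^sub>R u"
      using that unfolding eigenvalues_def by (rule CollectD)
    then obtain u where u: "u \<noteq> 0" "A *v u = c *\<^sub>R u"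
      by (elim exE conjE)
    then have "c * (u \<bullet> u) \<le> \<mu> * (u \<bullet> u)"
      using A[of u u] bound2[of u] by (metis inner_scaleR_right)
    then show ?thesis
      using u(1) by simp
  qed
  moreover have "finite (eigenvalues A)"
    by (rule finite_eigenvalues_symmetric) (metis A inner_commute)
  ultimately have "largest_eigenvalue A = \<mu>"
    unfolding largest_eigenvalue_def by (intro Max_eqI)
  then show "norm (L *v z) \<le> sqrt (largest_eigenvalue (transpose L ** L)) * norm z"
    using bound by (simp add: A_def \<mu>_def)
qed

section \<open>Short roundings in the unit cube\<close>

text \<open>Two fractional coordinates span a plane of directions in which \<open>v\<close> can move
  freely inside the cube. The single equation still leaves a line in that plane, so \<open>v\<close>
  would be the midpoint of a segment in the slice.\<close>

lemma extreme_point_cube_slice: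
  fixes g :: "real ^ 'd"
  assumes ext: "v extreme_point_of {v \<in> cbox 0 1. g \<bullet> v = b}"
    and i: "0 < v $ i" "v $ i < 1" and j: "0 < v $ j" "v $ j < 1"
  shows "i = j"
proof (rule ccontr)
  assume "i \<noteq> j"
  define S where "S = {v \<in> cbox 0 1. g \<bullet> v = b}"
  obtain h :: "real ^ 'd" where h: "h \<noteq> 0" "g \<bullet> h = 0" "\<And>k. k \<noteq> i \<Longrightarrow> k \<noteq> j \<Longrightarrow> h $ k = 0"
  proof (cases "g $ i = 0")
    case True
    have "axis i (1::real) \<noteq> 0"
      by (simp add: axis_eq_0_iff)
    then show ?thesis
      using True by (intro that[of "axis i 1"]) (simp_all add: inner_axis, simp add: axis_def)
  next
    case False
    define h where "h = (g $ j) *\<^sub>R axis i 1 - (g $ i) *\<^sub>R (axis j 1 :: real ^ 'd)"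
    have "h $ j = - g $ i"
      using \<open>i \<noteq> j\<close> by (simp add: h_def axis_def)
    then have "h \<noteq> 0"
      using False by auto
    then show ?thesis
      by (intro that[of h]) (auto simp: h_def inner_diff_right inner_axis, auto simp: axis_def)
  qed
  \<comment> \<open>\<open>m\<close> is the distance of the two coordinates to the bounds 0 and 1;
    scaling \<open>h\<close> by \<open>e\<close> keeps every coordinate change within it.\<close>
  define m where "m = min (min (v $ i) (1 - v $ i)) (min (v $ j) (1 - v $ j))"
  have "m > 0"
    using i j by (simp add: m_def)
  define e where "e = m / norm h"
  have "e > 0"
    using \<open>m > 0\<close> h(1) by (simp add: e_def)
  have eh: "\<bar>e * h $ k\<bar> \<le> m" for k
    using component_le_norm_cart[of h k] h(1) \<open>m > 0\<close>
    by (simp add: e_def abs_mult field_simps)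
  have "v \<in> S"
    using ext by (simp add: extreme_point_of_def S_def)
  have mem: "v + s *\<^sub>R (e *\<^sub>R h) \<in> S" if "\<bar>s\<bar> = 1" for s
  proof -
    have "0 \<le> v $ k + s * (e * h $ k) \<and> v $ k + s * (e * h $ k) \<le> 1" for k
    proof (cases "k = i \<or> k = j")
      case True
      have "\<bar>s * (e * h $ k)\<bar> \<le> m"
        using eh[of k] that by (simp add: abs_mult)
      moreover have "m \<le> v $ k" "m \<le> 1 - v $ k"
        using True by (auto simp: m_def)
      ultimately show ?thesis
        by linarith
    next
      case False
      then show ?thesis
        using h(3)[of k] \<open>v \<in> S\<close> by (auto simp: S_def mem_box_cart)
    qed
    then show ?thesis
      using \<open>v \<in> S\<close> h(2) by (simp add: S_def mem_box_cart inner_add_right mult.assoc)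
  qed
  have "v \<in> open_segment (v + (-1) *\<^sub>R (e *\<^sub>R h)) (v + 1 *\<^sub>R (e *\<^sub>R h))"
    unfolding in_segment
  proof (intro conjI exI[of _ "1/2"])
    show "v + (-1) *\<^sub>R (e *\<^sub>R h) \<noteq> v + 1 *\<^sub>R (e *\<^sub>R h)"
      using h(1) \<open>e > 0\<close> by (auto simp: vec_eq_iff)
    show "v = (1 - 1 / 2) *\<^sub>R (v + (-1) *\<^sub>R (e *\<^sub>R h)) + (1 / 2) *\<^sub>R (v + 1 *\<^sub>R (e *\<^sub>R h))"
      by (simp add: vec_eq_iff field_simps)
  qed auto
  then show False
    using ext mem[of 1] mem[of "-1"] by (simp add: extreme_point_of_def S_def)
qed

lemma cube_in_hull_short_roundings:
  fixes f :: "real ^ 'd"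
  assumes f: "f \<in> cbox 0 1"
  shows "f \<in> convex hull (int_lattice \<inter> cball f (sqrt ((real CARD('d) + 3) / 4)))"
    (is "f \<in> convex hull ?W")
proof -
  \<comment> \<open>A 0/1 coordinate equals its own square, so on cube vertices the squared distance
    to \<open>f\<close> is affine with gradient \<open>g\<close>.\<close>
  define g :: "real ^ 'd" where "g = (\<chi> i. 1 - 2 * f $ i)"
  define S where "S = {v \<in> cbox 0 1. g \<bullet> v = g \<bullet> f}"
  have dist2: "(dist f u)\<^sup>2 = g \<bullet> u + f \<bullet> f" if "\<And>i. u $ i = 0 \<or> u $ i = 1" for u
  proof -
    have "(u $ i - f $ i)\<^sup>2 = (1 - 2 * f $ i) * u $ i + f $ i * f $ i" for i
      using that[of i] by (auto simp: power2_eq_square algebra_simps)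
    then have "(\<Sum>i\<in>UNIV. (u $ i - f $ i)\<^sup>2) = g \<bullet> u + f \<bullet> f"
      by (simp add: inner_vec_def g_def sum.distrib)
    moreover have "(dist f u)\<^sup>2 = (\<Sum>i\<in>UNIV. (u $ i - f $ i)\<^sup>2)"
      unfolding dist_norm power2_norm_eq_inner
      by (simp add: inner_vec_def power2_eq_square algebra_simps)
    ultimately show ?thesis
      by simp
  qed
  \<comment> \<open>At \<open>f\<close> the affine function is the sum of the terms
    \<open>f $ i * (1 - f $ i)\<close>, each at most 1/4. The \<open>k\<close>-th term together with
    the rounding loss \<open>\<bar>g $ k\<bar>\<close> is at most 1, so the total is at most (d -
    1)/4 + 1 = (d + 3)/4.\<close>
  have near: "u \<in> ?W" if u: "\<And>i. u $ i = 0 \<or> u $ i = 1" and k: "g \<bullet> u \<le> g \<bullet> f + \<bar>g $ k\<bar>" for u k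
  proof -
    have quarter: "f $ i * (1 - f $ i) \<le> 1 / 4" for i
      using zero_le_power2[of "f $ i - 1 / 2"] by (simp add: power2_eq_square algebra_simps)
    have "0 \<le> f $ k" "f $ k \<le> 1"
      using f by (auto simp: mem_box_cart)
    \<comment> \<open>The first product settles the case \<open>f $ k > 1/2\<close>, the second the
      case \<open>f $ k \<le> 1/2\<close>.\<close>
    then have one: "f $ k * (1 - f $ k) + \<bar>g $ k\<bar> \<le> 1"
      using mult_nonneg_nonneg[of "1 - f $ k" "2 - f $ k"] mult_nonneg_nonneg[of "f $ k" "f $ k"]
      by (simp add: g_def abs_if algebra_simps)
    have "g \<bullet> f + f \<bullet> f = (\<Sum>i\<in>UNIV. f $ i * (1 - f $ i))"
      by (simp add: inner_vec_def g_def algebra_simps flip: sum.distrib)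
    also have "\<dots> = (\<Sum>i\<in>UNIV - {k}. f $ i * (1 - f $ i)) + f $ k * (1 - f $ k)"
      by (subst sum.remove[of _ k]) auto
    also have "(\<Sum>i\<in>UNIV - {k}. f $ i * (1 - f $ i)) \<le> (\<Sum>i\<in>UNIV - {k}. 1 / 4)"
      by (intro sum_mono quarter)
    also have "\<dots> = (real CARD('d) - 1) / 4"
      by (simp add: card_Diff_singleton of_nat_diff)
    finally have "(dist f u)\<^sup>2 \<le> (real CARD('d) + 3) / 4"
      using dist2[OF u] k one by (simp add: field_simps)
    then have "dist f u \<le> sqrt ((real CARD('d) + 3) / 4)"
      by (rule real_le_rsqrt)
    moreover have "u \<in> int_lattice"
      unfolding int_lattice_def
    proof safe
      show "u $ i \<in> \<int>" for i
        using u[of i] by auto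
    qed
    ultimately show ?thesis
      by simp
  qed
  have hyper: "{v. g \<bullet> v = g \<bullet> f} \<inter> cbox 0 1 = S"
    by (auto simp: S_def)
  have "compact S"
    using closed_Int_compact[OF closed_hyperplane compact_cbox] hyper by metis
  moreover have "convex S"
    using convex_Int[OF convex_hyperplane convex_box(1)] hyper by metis
  ultimately have "S = convex hull {v. v extreme_point_of S}"
    by (rule Krein_Milman_Minkowski)
  moreover have "f \<in> S"
    using f by (simp add: S_def)
  moreover have "v \<in> convex hull ?W" if v: "v extreme_point_of S" for v
  proof -
    have "v \<in> S"
      using v by (simp add: extreme_point_of_def)
    then have v01: "0 \<le> v $ i" "v $ i \<le> 1" and gv: "g \<bullet> v = g \<bullet> f" for i
      by (auto simp: S_def mem_box_cart)
    show ?thesis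
    proof (cases "\<forall>i. v $ i = 0 \<or> v $ i = 1")
      case True
      then have "v \<in> ?W"
        by (intro near) (auto simp: gv)
      then show ?thesis
        by (rule hull_inc)
    next
      case False
      then obtain k where k: "0 < v $ k" "v $ k < 1"
        using v01 by (metis less_eq_real_def)
      have int: "v $ i = 0 \<or> v $ i = 1" if "i \<noteq> k" for i
        using extreme_point_cube_slice[OF v[unfolded S_def] k, of i] that v01[of i]
        by (auto simp: less_le)
      \<comment> \<open>\<open>u c\<close> replaces the only fractional coordinate of
        \<open>v\<close> by \<open>c\<close>. Both roundings satisfy \<open>near\<close>, and
        \<open>v\<close> is their mean with weights \<open>1 - v $ k\<close> and
        \<open>v $ k\<close>.\<close>
      define u where "u c = v + (c - v $ k) *\<^sub>R axis k 1" for c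
      have "u c \<in> ?W" if c: "c = 0 \<or> c = 1" for c
      proof (rule near)
        show "u c $ i = 0 \<or> u c $ i = 1" for i
          using int[of i] c by (auto simp: u_def axis_def)
        have "(c - v $ k) * g $ k \<le> \<bar>c - v $ k\<bar> * \<bar>g $ k\<bar>"
          by (metis abs_ge_self abs_mult)
        also have "\<dots> \<le> 1 * \<bar>g $ k\<bar>"
          by (rule mult_right_mono) (use c k in auto)
        finally show "g \<bullet> u c \<le> g \<bullet> f + \<bar>g $ k\<bar>"
          by (simp add: u_def inner_add_right inner_axis gv)
      qed
      then have "(1 - v $ k) *\<^sub>R u 0 + (v $ k) *\<^sub>R u 1 \<in> convex hull ?W"
        using k by (intro convexD[OF convex_convex_hull] hull_inc) auto
      also have "(1 - v $ k) *\<^sub>R u 0 + (v $ k) *\<^sub>R u 1 = v"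
        by (simp add: u_def vec_eq_iff algebra_simps)
      finally show ?thesis .
    qed
  qed
  ultimately show ?thesis
    by (metis (no_types, lifting) convex_convex_hull hull_minimal mem_Collect_eq subsetD subsetI)
qed

text \<open>Translation by the integer vector of floors reduces to the unit cube. Consequently a set
  containing the ball of this radius around \<open>x\<close> has \<open>x\<close> in its integer
  hull.\<close>

lemma in_hull_near_lattice_points:
  fixes x :: "real ^ 'd"
  shows "x \<in> convex hull (int_lattice \<inter> cball x (sqrt ((real CARD('d) + 3) / 4)))"
proof -
  define r where "r = sqrt ((real CARD('d) + 3) / 4)"
  define m :: "real ^ 'd" where "m = (\<chi> i. of_int \<lfloor>x $ i\<rfloor>)"
  have "0 \<le> x $ i - of_int \<lfloor>x $ i\<rfloor>" "x $ i - of_int \<lfloor>x $ i\<rfloor> \<le> 1" for i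
    by linarith+
  then have "x - m \<in> cbox 0 1"
    by (simp add: mem_box_cart m_def)
  then have "x - m \<in> convex hull (int_lattice \<inter> cball (x - m) r)"
    unfolding r_def by (rule cube_in_hull_short_roundings)
  then have "m + (x - m) \<in> (+) m ` (convex hull (int_lattice \<inter> cball (x - m) r))"
    by (rule imageI)
  also have "\<dots> = convex hull ((+) m ` (int_lattice \<inter> cball (x - m) r))"
    by (simp add: convex_hull_translation)
  also have "\<dots> \<subseteq> convex hull (int_lattice \<inter> cball x r)"
  proof (rule hull_mono, safe)
    fix y :: "real ^ 'd" assume "y \<in> int_lattice"
    then show "m + y \<in> int_lattice"
      by (simp add: int_lattice_def m_def)
  next
    fix y assume "y \<in> cball (x - m) r"
    then show "m + y \<in> cball x r"
      by (simp add: dist_norm algebra_simps)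
  qed
  finally show ?thesis
    by (simp add: r_def)
qed

section \<open>Depth with respect to the standard lattice\<close>

text \<open>The bound \<open>C\<close> must not depend on \<open>z\<close>, since strictness at each
  point could be lost in the supremum that defines depth. The witness is
  \<open>frac (Sup Q)\<close>: a point \<open>z\<close> outside the hull lies beyond the last
  integer of \<open>Q\<close>, and closedness keeps \<open>Sup Q\<close> below the next one. If
  \<open>Q\<close> is unbounded above, no such \<open>z\<close> exists.\<close>

lemma interval_depth_bound_right:
  fixes Q :: "real set"
  assumes "closed Q" "convex Q" "0 \<in> Q"
  shows "\<exists>C<1. \<forall>z \<rho>. 0 < z \<longrightarrow> 0 \<le> \<rho> \<longrightarrow> cball z \<rho> \<subseteq> Q \<longrightarrow> z \<notin> convex hull (Q \<inter> \<int>) \<longrightarrow> \<rho> \<le> C"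
proof -
  have le: "\<rho> \<le> frac (Sup Q)"
    if z: "0 < z" "0 \<le> \<rho>" "cball z \<rho> \<subseteq> Q" "z \<notin> convex hull (Q \<inter> \<int>)" for z \<rho>
  proof -
    define m where "m = \<lfloor>z\<rfloor>"
    have m: "0 \<le> m" "of_int m \<le> z" "z < of_int m + 1"
      using z(1) by (simp_all add: m_def)
    have mem: "z \<in> Q" "z + \<rho> \<in> Q"
      using z(2,3) by (auto simp: dist_norm)
    have between: "t \<in> Q" if "0 \<le> t" "t \<le> s" "s \<in> Q" for s t
      using that assms(2,3) by (metis is_interval_convex_1 mem_is_interval_1_I)
    have "of_int m \<in> Q"
      using between[of "of_int m" z] m mem(1) by simp
    \<comment> \<open>Otherwise \<open>z\<close> would lie on the segment between two integers of
      \<open>Q\<close>.\<close>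
    have "of_int m + 1 \<notin> Q"
    proof
      assume "of_int m + 1 \<in> Q"
      then have "{of_int m, of_int m + 1} \<subseteq> Q \<inter> \<int>"
        using \<open>of_int m \<in> Q\<close> by auto
      then have "closed_segment (of_int m) (of_int m + 1) \<subseteq> convex hull (Q \<inter> \<int>)"
        unfolding segment_convex_hull by (rule hull_mono)
      then show False
        using m z(4) by (auto simp: closed_segment_eq_real_ivl subset_iff)
    qed
    then have ub: "s < of_int m + 1" if "s \<in> Q" for s
      using between[of "of_int m + 1" s] m(1) that by force
    then have bdd: "bdd_above Q"
      by (meson bdd_above.I less_imp_le)
    then have "Sup Q \<in> Q"
      using assms by (intro closed_contains_Sup) auto
    then have "Sup Q < of_int m + 1"
      by (rule ub)
    moreover have "z + \<rho> \<le> Sup Q"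
      using mem(2) bdd by (rule cSup_upper)
    ultimately have "\<lfloor>Sup Q\<rfloor> = m"
      using m z(2) by linarith
    then show ?thesis
      using \<open>z + \<rho> \<le> Sup Q\<close> m(2) by (simp add: frac_def)
  qed
  show ?thesis
    using le frac_lt_1 by blast
qed

text \<open>Reflection at 0 handles negative \<open>z\<close>, and \<open>z = 0\<close> is itself an
  integer point of \<open>Q\<close>.\<close>

lemma interval_depth_bound:
  fixes Q :: "real set"
  assumes "closed Q" "convex Q" "0 \<in> Q"
  shows "\<exists>C<1. \<forall>z \<rho>. 0 \<le> \<rho> \<longrightarrow> cball z \<rho> \<subseteq> Q \<longrightarrow> z \<notin> convex hull (Q \<inter> \<int>) \<longrightarrow> \<rho> \<le> C"
proof -
  obtain C1 where C1: "C1 < 1"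
    "\<And>z \<rho>. 0 < z \<Longrightarrow> 0 \<le> \<rho> \<Longrightarrow> cball z \<rho> \<subseteq> Q \<Longrightarrow> z \<notin> convex hull (Q \<inter> \<int>) \<Longrightarrow> \<rho> \<le> C1"
    using interval_depth_bound_right[OF assms] by blast
  have "closed (uminus ` Q)" "convex (uminus ` Q)" "0 \<in> uminus ` Q"
    using assms closed_negations convex_negations by force+
  then obtain C2 where C2: "C2 < 1" "\<And>z \<rho>. 0 < z \<Longrightarrow> 0 \<le> \<rho> \<Longrightarrow> cball z \<rho> \<subseteq> uminus ` Q \<Longrightarrow>
      z \<notin> convex hull (uminus ` Q \<inter> \<int>) \<Longrightarrow> \<rho> \<le> C2"
    using interval_depth_bound_right[of "uminus ` Q"] by blast
  have "\<rho> \<le> max C1 C2" if z: "0 \<le> \<rho>" "cball z \<rho> \<subseteq> Q" "z \<notin> convex hull (Q \<inter> \<int>)" for z \<rho>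
  proof -
    have "z \<noteq> 0"
      using z(3) assms(3) hull_inc[of 0 "Q \<inter> \<int>"] by auto
    then consider "0 < z" | "0 < - z"
      by linarith
    then show ?thesis
    proof cases
      case 1
      then show ?thesis
        using C1(2) z by fastforce
    next
      case 2
      have "cball (- z) \<rho> \<subseteq> uminus ` Q"
      proof
        fix y assume "y \<in> cball (- z) \<rho>"
        then have "- y \<in> cball z \<rho>"
          by (simp add: dist_norm abs_minus_commute add.commute)
        then show "y \<in> uminus ` Q"
          using z(2) by force
      qed
      moreover have "- z \<notin> convex hull (uminus ` Q \<inter> \<int>)"
      proof
        have "uminus ` Q \<inter> \<int> = uminus ` (Q \<inter> \<int>)"
          by force
        moreover assume "- z \<in> convex hull (uminus ` Q \<inter> \<int>)"
        ultimately have "- z \<in> uminus ` (convex hull (Q \<inter> \<int>))"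
          using convex_hull_linear_image[OF module_hom_uminus] by metis
        then show False
          using z(3) by auto
      qed
      ultimately show ?thesis
        using C2(2)[OF 2 z(1)] by fastforce
    qed
  qed
  then show ?thesis
    using C1(1) C2(1) by (metis max_less_iff_conj)
qed

lemma integer_hull_depth_bound:
  fixes P :: "(real ^ 'd) set"
  assumes "closed P" "convex P" "0 \<in> P"
  shows "\<exists>C < sqrt ((real CARD('d) + 1) / 2). \<forall>z \<rho>. 0 \<le> \<rho> \<longrightarrow> cball z \<rho> \<subseteq> P \<longrightarrow>
    z \<notin> integer_hull P \<longrightarrow> \<rho> \<le> C"
proof (cases "CARD('d) = 1")
  case False
  have "CARD('d) > 0"
    by (rule zero_less_card_finite)
  with False have "1 < CARD('d)"
    by linarith
  then have "sqrt ((real CARD('d) + 3) / 4) < sqrt ((real CARD('d) + 1) / 2)"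
    by (simp add: field_simps)
  moreover have "\<rho> \<le> sqrt ((real CARD('d) + 3) / 4)"
    if "cball z \<rho> \<subseteq> P" "z \<notin> integer_hull P" for z \<rho>
  proof (rule ccontr)
    assume "\<not> ?thesis"
    \<comment> \<open>A larger \<open>\<rho>\<close> puts all lattice points near \<open>z\<close>
      into \<open>P\<close>, and these already have \<open>z\<close> in their hull.\<close>
    then have "int_lattice \<inter> cball z (sqrt ((real CARD('d) + 3) / 4)) \<subseteq> P \<inter> int_lattice"
      using that(1) by auto
    then show False
      using in_hull_near_lattice_points[of z] that(2) hull_mono
      unfolding integer_hull_def by blast
  qed
  ultimately show ?thesis
    by blast
next
  case True
  \<comment> \<open>In dimension one \<open>vec\<close> is a linear isometry from the reals with
    inverse \<open>z $ i\<close>, so the interval bound applies; the target radius is then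
    1.\<close>
  then obtain i :: 'd where i: "UNIV = {i}"
    by (auto simp: card_1_singleton_iff)
  have all: "j = i" for j
    using i by auto
  have vec: "vec (z $ i) = z" for z :: "real ^ 'd"
    by (simp add: vec_eq_iff) (metis all)
  have dist: "dist (vec s :: real ^ 'd) (vec t) = dist s t" for s t :: real
    by (simp add: dist_vec_def i)
  define Q where "Q = (vec :: real \<Rightarrow> real ^ 'd) -` P"
  have "closed Q"
    unfolding Q_def by (intro continuous_closed_vimage assms(1) linear_continuous_at
        linear_conv_bounded_linear[THEN iffD1] linear_vec)
  moreover have "convex Q"
    unfolding Q_def using linear_vec assms(2) by (rule convex_linear_vimage)
  moreover have "0 \<in> Q"
    using assms(3) by (simp add: Q_def vec_0)
  ultimately obtain C where C: "C < 1"
    "\<And>z \<rho>. 0 \<le> \<rho> \<Longrightarrow> cball z \<rho> \<subseteq> Q \<Longrightarrow> z \<notin> convex hull (Q \<inter> \<int>) \<Longrightarrow> \<rho> \<le> C"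
    using interval_depth_bound by blast
  have "\<rho> \<le> C" if z: "0 \<le> \<rho>" "cball z \<rho> \<subseteq> P" "z \<notin> integer_hull P" for z \<rho>
  proof (rule C(2)[OF z(1)])
    show "cball (z $ i) \<rho> \<subseteq> Q"
    proof
      fix t assume "t \<in> cball (z $ i) \<rho>"
      then have "vec t \<in> cball z \<rho>"
        using dist[of "z $ i" t] by (simp add: vec)
      then show "t \<in> Q"
        using z(2) by (auto simp: Q_def)
    qed
    show "z $ i \<notin> convex hull (Q \<inter> \<int>)"
    proof
      assume "z $ i \<in> convex hull (Q \<inter> \<int>)"
      then have "vec (z $ i) \<in> (vec :: real \<Rightarrow> real ^ 'd) ` (convex hull (Q \<inter> \<int>))"
        by (rule imageI)
      also have "\<dots> = convex hull (vec ` (Q \<inter> \<int>))"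
        by (rule convex_hull_linear_image[OF linear_vec])
      also have "\<dots> \<subseteq> integer_hull P"
        unfolding integer_hull_def by (rule hull_mono) (auto simp: Q_def int_lattice_def)
      finally show False
        using z(3) by (simp add: vec)
    qed
  qed
  then show ?thesis
    using C(1) True by auto
qed

section \<open>Transfer along the lattice basis\<close>

lemma closed_convex_rational_polyhedron:
  assumes "rational_polyhedron P"
  shows "closed P" "convex P"
proof -
  obtain F where "P = {x. \<forall>(a, b)\<in>F. a \<bullet> x \<le> b}"
    using assms by (auto simp: rational_polyhedron_def)
  then have "P = (\<Inter>(a, b)\<in>F. {x. a \<bullet> x \<le> b})"
    by auto
  then show "closed P" "convex P"
    by (auto intro!: closed_INT convex_INT closed_halfspace_le convex_halfspace_le)
qed

text \<open>\<open>columns L\<close> is a set, so distinctness of the columns is what turns its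
  independence into full column rank.\<close>

lemma lattice_basis_inj:
  fixes L :: "real ^ 'd ^ 'n"
  assumes "lattice_basis L \<Lambda>"
  shows "inj ((*v) L)"
proof -
  have "columns L = range (\<lambda>j. column j L)"
    by (auto simp: columns_def)
  then have "card (columns L) = CARD('d)"
    using assms by (simp add: lattice_basis_def card_image)
  then have "dim (columns L) = CARD('d)"
    using assms by (simp add: lattice_basis_def dim_eq_card_independent)
  then show ?thesis
    by (metis full_rank_injective column_rank_def)
qed

text \<open>As 0 lies in \<open>P\<close>, the affine hull is a subspace. The columns are images of
  integer unit vectors and thus lie in it, and both subspaces have dimension
  \<open>CARD('d)\<close>.\<close>

lemma lattice_basis_affine_hull:
  fixes P :: "(real ^ 'n) set" and L :: "real ^ 'd ^ 'n"
  assumes "0 \<in> P" "aff_dim P = int CARD('d)" "lattice_basis L (int_lattice \<inter> affine hull P)"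
  shows "affine hull P = range ((*v) L)"
proof -
  have sp: "affine hull P = span P"
    using assms(1) by (simp add: affine_hull_span_0 hull_inc)
  have "axis j 1 \<in> int_lattice" for j :: 'd
    by (auto simp: int_lattice_def axis_def)
  then have "L *v axis j 1 \<in> affine hull P" for j
    using assms(3) unfolding lattice_basis_def by blast
  then have "columns L \<subseteq> span P"
    by (auto simp: columns_def sp matrix_vector_mult_basis)
  then have "range ((*v) L) \<subseteq> span P"
    using matrix_vector_mult_in_columnspace span_minimal subspace_span by blast
  moreover have "dim (span P) \<le> dim (range ((*v) L))"
  proof -
    have "dim (range ((*v) L)) = CARD('d)"
      using lattice_basis_inj[OF assms(3)] by (simp add: dim_image_eq)
    moreover have "int (dim P) = int CARD('d)"
      using assms(1,2) aff_dim_zero[of P] hull_inc[of 0 P affine] by simp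
    ultimately show ?thesis
      by simp
  qed
  moreover have "subspace (range ((*v) L))"
    by (simp add: linear_subspace_image)
  ultimately have "range ((*v) L) = span P"
    by (intro subspace_dim_equal) auto
  then show ?thesis
    using sp by simp
qed

theorem corollary1:
  fixes P :: "(real ^ 'n) set" and L :: "real ^ 'd ^ 'n"
  assumes "CARD('n) \<ge> 2"
    and "rational_polyhedron P"
    and "integer_hull P \<noteq> {}"
    and "0 \<in> P"
    and "aff_dim P = int CARD('d)"
    and "\<forall>i j. L $ i $ j \<in> \<int>"
    and "lattice_basis L (int_lattice \<inter> affine hull P)"
  shows "depth P (integer_hull P)
           < ennreal (sqrt (largest_eigenvalue (transpose L ** L))
                      * sqrt ((real CARD('d) + 1) / 2))"
proof -
  define s where "s = sqrt (largest_eigenvalue (transpose L ** L))"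
  have norm_le: "norm (L *v z) \<le> s * norm z" for z
    unfolding s_def by (rule norm_matrix_vector_le_largest_eigenvalue)
  \<comment> \<open>Positivity allows radii to be divided by \<open>s\<close> and preserves the
    strict inequality at the end.\<close>
  have "s > 0"
  proof -
    obtain v :: "real ^ 'd" where v: "v \<noteq> 0"
      by (metis axis_eq_0_iff zero_neq_one)
    then have "L *v v \<noteq> 0"
      using lattice_basis_inj[OF assms(7)] by (metis injD matrix_vector_mult_0_right)
    then have "0 < s * norm v"
      using norm_le[of v] by (metis less_le_trans zero_less_norm_iff)
    then show ?thesis
      using v by (simp add: zero_less_mult_iff)
  qed
  have lin: "linear ((*v) L)"
    by simp
  define P' where "P' = (*v) L -` P"
  note cc = closed_convex_rational_polyhedron[OF assms(2)]
  have "closed P'"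
    unfolding P'_def by (intro continuous_closed_vimage cc(1) linear_continuous_at
        linear_conv_bounded_linear[THEN iffD1] lin)
  moreover have "convex P'"
    unfolding P'_def using lin cc(2) by (rule convex_linear_vimage)
  moreover have "0 \<in> P'"
    using assms(4) by (simp add: P'_def)
  ultimately obtain C where C: "C < sqrt ((real CARD('d) + 1) / 2)"
    "\<And>z \<rho>. 0 \<le> \<rho> \<Longrightarrow> cball z \<rho> \<subseteq> P' \<Longrightarrow> z \<notin> integer_hull P' \<Longrightarrow> \<rho> \<le> C"
    using integer_hull_depth_bound by blast
  have hull: "(*v) L ` integer_hull P' \<subseteq> integer_hull P"
  proof -
    have "(*v) L ` (P' \<inter> int_lattice) \<subseteq> P \<inter> int_lattice"
      using assms(7) by (auto simp: P'_def lattice_basis_def)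
    then show ?thesis
      unfolding integer_hull_def using convex_hull_linear_image[OF lin] hull_mono by metis
  qed
  have "ennreal r \<le> ennreal (s * C)"
    if x: "x \<in> P" "x \<notin> integer_hull P" and r: "0 \<le> r" "cball x r \<inter> affine hull P \<subseteq> P" for x r
  proof -
    have aff: "affine hull P = range ((*v) L)"
      using assms(4,5,7) by (rule lattice_basis_affine_hull)
    moreover have "x \<in> affine hull P"
      using x(1) by (rule hull_inc)
    ultimately obtain z where z: "x = L *v z"
      by auto
    \<comment> \<open>\<open>L\<close> stretches distances by at most \<open>s\<close> and its range
      is the affine hull, so this ball is mapped into
      \<open>cball x r \<inter> affine hull P\<close>.\<close>
    have "cball z (r / s) \<subseteq> P'"
    proof
      fix y assume "y \<in> cball z (r / s)"
      then have "s * norm (z - y) \<le> r"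
        using \<open>s > 0\<close> by (simp add: dist_norm field_simps)
      then have "dist (L *v z) (L *v y) \<le> r"
        using norm_le[of "z - y"] by (simp add: dist_norm matrix_vector_mult_diff_distrib)
      then show "y \<in> P'"
        using r(2) aff z by (auto simp: P'_def)
    qed
    moreover have "z \<notin> integer_hull P'"
      using hull x(2) z by blast
    ultimately have "r / s \<le> C"
      using C(2) r(1) \<open>s > 0\<close> by simp
    then show ?thesis
      using \<open>s > 0\<close> by (intro ennreal_leI) (simp add: field_simps)
  qed
  then have "depth P (integer_hull P) \<le> ennreal (s * C)"
    unfolding depth_def point_depth_def by (auto intro!: SUP_least Sup_least)
  \<comment> \<open>The supremum stays strictly below the bound because one \<open>C\<close> serves
    all points and radii.\<close>
  also have "\<dots> < ennreal (s * sqrt ((real CARD('d) + 1) / 2))"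
    using \<open>s > 0\<close> C(1) by (intro ennreal_lessI) auto
  finally show ?thesis
    by (simp add: s_def)
qed

end
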